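(* In online matching with online items and non-myopic offline agents with private graph edges, every randomized truthful mechanism, even if it is tardy, has competitive ratio at least $\Omega(\log\nu/\log\log\nu)$, where $\nu=\min(m,n)$, $n$ is the number of buyers and $m$ the number of items (the implied constant is absolute and the asymptotics are as $\nu\to\infty$).
   Context: Model. There is a bipartite graph $G=(B,I;E)$ with a set $B$ of $n$ buyers, known in advance, and a set $I$ of $m$ items arriving one by one in an unknown, possibly adversarial order (item $j$ arrives at time $j$). Buyer $i$ is interested in the items $j$ with $(i,j)\in E$, and has a value $v_i\ge 0$ for obtaining at least one item she is interested in (value $0$ otherwise). Private graph edges: both $v_i$ and the set of items $i$ is interested in are private information of $i$. When item $j$ arrives, every buyer declares whether she is interested in $j$ and, if so, a value; she may misreport both. All nonzero bids of buyer $i$ must equal a single value $b_i$ (a bid of $0$ meaning not interested). A mechanism, possibly randomized, decides upon the arrival of $j$, immediately and irrevocably and using only the bids on items up to $j$, either to assign $j$ to a buyer who declared interest in it and has not been assigned an item yet, or to leave $j$ unassigned forever. The result is a (random) matching $\mu$ ($\mu^{-1}_i$ is the item received by $i$, $\emptyset$ if none). The mechanism also charges non-negative payments $p_i$; it is tardy if payments are computed at the end of the whole process. Welfare. $\mathrm{SW}(\mu)=\sum_{i\in B} v_i\cdot \mathbb{I}[(i,\mu^{-1}_i)\in E]$, and $\mathrm{OPT}=\mathrm{SW}(\mu^\star)$ where $\mu^\star$ is a maximum weight matching in $G$. A mechanism is $\alpha$-competitive ($\alpha\ge 1$) on instances with $n$ buyers and $m$ items if $\mathrm{OPT}\le\alpha\cdot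 \mathbb{E}[\mathrm{SW}(\mu)]$ on all such instances (with truthful reports); its competitive ratio is the infimum of such $\alpha$ ($+\infty$ if none exists). Truthfulness. Non-myopic buyers know the whole sequence of items and maximize the quasi-linear utility $u_i=v_i\cdot\mathbb{I}[(i,\mu_i^{-1})\in E]-p_i$. A mechanism is truthful (in the ex-post sense) if, for every realization of the mechanism's random choices, every instance and every behavior of the other buyers, each agent maximizes her utility by reporting her value and her interests truthfully; thus a randomized truthful mechanism is a probability distribution over deterministic truthful mechanisms. Mechanisms are required to be ex-post individually rational: truthful agents have non-negative utility in every realization. *)

theory Defs
  imports "HOL-Probability.Probability"
begin

text \<open>
  Buyers are \<open>0, \<dots>, n - 1\<close>; items are \<open>0, \<dots>, m - 1\<close>, numbered in their order of arrival.  Since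
  all instances are considered, this covers every arrival order.
\<close>

definition market :: "nat \<Rightarrow> nat \<Rightarrow> (nat \<Rightarrow> real) \<Rightarrow> (nat \<times> nat) set \<Rightarrow> bool" where
  "market n m v E \<longleftrightarrow> (\<forall>i<n. 0 \<le> v i) \<and> E \<subseteq> {..<n} \<times> {..<m}"

text \<open>A matching is a partial map from items to buyers.\<close>

definition matching :: "(nat \<times> nat) set \<Rightarrow> (nat \<rightharpoonup> nat) \<Rightarrow> bool" where
  "matching E \<mu> \<longleftrightarrow> (\<forall>i j. \<mu> j = Some i \<longrightarrow> (i, j) \<in> E) \<and> inj_on \<mu> (dom \<mu>)"

text \<open>
  An item that buyer \<open>i\<close> receives without being interested in it contributes nothing.
\<close>

definition served :: "(nat \<times> nat) set \<Rightarrow> (nat \<rightharpoonup> nat) \<Rightarrow> nat \<Rightarrow> bool" where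
  "served E \<mu> i \<longleftrightarrow> (\<exists>j. \<mu> j = Some i \<and> (i, j) \<in> E)"

definition welfare :: "nat \<Rightarrow> (nat \<Rightarrow> real) \<Rightarrow> (nat \<times> nat) set \<Rightarrow> (nat \<rightharpoonup> nat) \<Rightarrow> real" where
  "welfare n v E \<mu> = (\<Sum>i<n. v i * of_bool (served E \<mu> i))"

definition opt :: "nat \<Rightarrow> (nat \<Rightarrow> real) \<Rightarrow> (nat \<times> nat) set \<Rightarrow> real" where
  "opt n v E = Max (welfare n v E ` {\<mu>. matching E \<mu>})"

lemma matching_empty: "matching E Map.empty"
  by (simp add: matching_def)

lemma finite_matchings:
  assumes "finite E"
  shows "finite {\<mu>. matching E \<mu>}"
proof (rule inj_on_finite)
  show "inj_on (\<lambda>\<mu>. {(i, j). \<mu> j = Some i}) {\<mu>. matching E \<mu>}"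
  proof (rule inj_onI)
    fix \<mu> \<mu>' :: "nat \<rightharpoonup> nat"
    assume "{(i, j). \<mu> j = Some i} = {(i, j). \<mu>' j = Some i}"
    then have "\<mu> j = Some i \<longleftrightarrow> \<mu>' j = Some i" for i j
      by (auto simp: set_eq_iff)
    then show "\<mu> = \<mu>'"
      by (metis ext not_Some_eq)
  qed
  show "(\<lambda>\<mu>. {(i, j). \<mu> j = Some i}) ` {\<mu>. matching E \<mu>} \<subseteq> Pow E"
    by (auto simp: matching_def)
  show "finite (Pow E)"
    using assms by simp
qed

text \<open>
  A bid profile gives the bid of every buyer on every item; a bid of \<open>0\<close> means ``not interested''.
  Bids outside the market are fixed to \<open>0\<close>, so that a profile carries no further information.
\<close>

type_synonym bids = "nat \<Rightarrow> nat \<Rightarrow> real"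

definition bid_profiles :: "nat \<Rightarrow> nat \<Rightarrow> bids set" where
  "bid_profiles n m =
    {b. (\<forall>i j. b i j \<noteq> 0 \<longrightarrow> i < n \<and> j < m) \<and> (\<forall>i. \<exists>x\<ge>0. \<forall>j. b i j = 0 \<or> b i j = x)}"

definition truthful_bids :: "(nat \<Rightarrow> real) \<Rightarrow> (nat \<times> nat) set \<Rightarrow> bids" where
  "truthful_bids v E i j = (if (i, j) \<in> E then v i else 0)"

record mechanism =
  assign :: "bids \<Rightarrow> nat \<rightharpoonup> nat"
  pay :: "bids \<Rightarrow> nat \<Rightarrow> real"

text \<open>
  Assignments are made online, whereas payments may depend on the entire bid profile (tardiness).
  The matching property with respect to the declared graph says that an item only goes to a buyer
  who declared interest in it and that no buyer gets two items.
\<close>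

definition online_mechanism :: "nat \<Rightarrow> nat \<Rightarrow> mechanism \<Rightarrow> bool" where
  "online_mechanism n m A \<longleftrightarrow>
    (\<forall>b \<in> bid_profiles n m. matching {(i, j). b i j \<noteq> 0} (assign A b)) \<and>
    (\<forall>b \<in> bid_profiles n m. \<forall>b' \<in> bid_profiles n m. \<forall>j<m.
      (\<forall>i<n. \<forall>k\<le>j. b i k = b' i k) \<longrightarrow> assign A b j = assign A b' j) \<and>
    (\<forall>b \<in> bid_profiles n m. \<forall>i<n. 0 \<le> pay A b i)"

definition utility :: "(nat \<Rightarrow> real) \<Rightarrow> (nat \<times> nat) set \<Rightarrow> mechanism \<Rightarrow> bids \<Rightarrow> nat \<Rightarrow> real" where
  "utility v E A b i = v i * of_bool (served E (assign A b) i) - pay A b i"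

text \<open>
  In the following two notions, \<open>b\<close> is a profile in which buyer \<open>i\<close> is truthful and all other
  buyers behave arbitrarily; \<open>r\<close> is an arbitrary report of buyer \<open>i\<close>.
\<close>

definition truthful :: "nat \<Rightarrow> nat \<Rightarrow> mechanism \<Rightarrow> bool" where
  "truthful n m A \<longleftrightarrow>
    (\<forall>v E. market n m v E \<longrightarrow>
      (\<forall>i<n. \<forall>b \<in> bid_profiles n m. b i = truthful_bids v E i \<longrightarrow>
        (\<forall>r. b(i := r) \<in> bid_profiles n m \<longrightarrow>
          utility v E A (b(i := r)) i \<le> utility v E A b i)))"

definition individually_rational :: "nat \<Rightarrow> nat \<Rightarrow> mechanism \<Rightarrow> bool" where
  "individually_rational n m A \<longleftrightarrow>
    (\<forall>v E. market n m v E \<longrightarrow>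
      (\<forall>i<n. \<forall>b \<in> bid_profiles n m. b i = truthful_bids v E i \<longrightarrow> 0 \<le> utility v E A b i))"

text \<open>
  A randomized truthful mechanism is a probability measure on deterministic ones.  Its
  \<open>\<sigma>\<close>-algebra is arbitrary, as long as the resulting matching is a random variable for every bid
  profile.
\<close>

definition randomized_truthful_mechanism :: "nat \<Rightarrow> nat \<Rightarrow> mechanism measure \<Rightarrow> bool" where
  "randomized_truthful_mechanism n m R \<longleftrightarrow>
    prob_space R \<and>
    (\<forall>A \<in> space R. online_mechanism n m A \<and> truthful n m A \<and> individually_rational n m A) \<and>
    (\<forall>b \<in> bid_profiles n m. \<forall>j<m. (\<lambda>A. assign A b j) \<in> R \<rightarrow>\<^sub>M count_space UNIV)"

definition competitive :: "nat \<Rightarrow> nat \<Rightarrow> mechanism measure \<Rightarrow> real \<Rightarrow> bool" where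
  "competitive n m R \<alpha> \<longleftrightarrow>
    (\<forall>v E. market n m v E \<longrightarrow>
      opt n v E \<le> \<alpha> * (\<integral>A. welfare n v E (assign A (truthful_bids v E)) \<partial>R))"

text \<open>The infimum is taken in the extended reals, hence \<open>\<infinity>\<close> if no \<open>\<alpha>\<close> qualifies.\<close>

definition competitive_ratio :: "nat \<Rightarrow> nat \<Rightarrow> mechanism measure \<Rightarrow> ereal" where
  "competitive_ratio n m R = Inf (ereal ` {\<alpha>. 1 \<le> \<alpha> \<and> competitive n m R \<alpha>})"

end

theory Submission imports Defs "HOL-Real_Asymp.Real_Asymp" begin

text \<open>
  In a deterministic truthful mechanism, fix the bids of the others.  A buyer who is interested in
  all items is offered one particular item, independently of her own bid, except for the lowest bid
  with which she wins anything: the mechanism cannot give her an early item for some values and keep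
  her waiting for others.

  The hard instances have phases \<open>0, \<dots>, K - 1\<close> with \<open>K ^ t\<close> items in phase \<open>t\<close>, as many buyers
  as items, and independent random values that are \<open>(2 / K) ^ t\<close> with probability proportional to
  \<open>K ^ t\<close>.  All buyers want all items, and the arrival stops after some phase \<open>t\<close>, where the optimum
  is of order \<open>2 ^ t\<close>.  Weighting the stopping times by \<open>2 ^ (- t)\<close>, the optimum is at least
  \<open>K / 2\<close>.  For the mechanism, buyers served with a lower value than the phase of
  their item is meant for gain \<open>O(1)\<close> because the supply is limited; the others gain \<open>O(1)\<close> because
  every buyer has to be committed to a single phase before her value matters.  So the ratio is of
  order \<open>K\<close>, and \<open>K ^ K \<le> \<nu>\<close> admits \<open>K\<close> of order \<open>ln \<nu> / ln (ln \<nu>)\<close>.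
\<close>

section \<open>Winning items and bids in a deterministic truthful mechanism\<close>

lemma bid_profiles_update:
  assumes "b \<in> bid_profiles n m" "i < n" "k \<le> m" "0 \<le> x"
  shows "b(i := \<lambda>j. if j < k then x else 0) \<in> bid_profiles n m"
  using assms unfolding bid_profiles_def by (auto simp: less_le_trans split: if_splits)

text \<open>
  A buyer who can win by bidding \<open>e\<close> pays at most \<open>e\<close> for any higher bid.  If two such bids
  won different items, consider a buyer with the value that wins later but whose interest ends with
  the earlier item.  She could imitate the other bid at a price of at most \<open>e\<close>, so she has to
  be served; since her bids agree so far, this contradicts the later win.
\<close>

lemma higher_bids_win_same_item:
  assumes A: "online_mechanism n m A" "truthful n m A" "individually_rational n m A"
    and b: "b \<in> bid_profiles n m" and i: "i < n" and k: "k \<le> m"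
    and pos: "0 < e" "e < x" "e < y"
    and win: "assign A (b(i := \<lambda>j. if j < k then e else 0)) l = Some i"
  obtains j where "assign A (b(i := \<lambda>j. if j < k then x else 0)) j = Some i"
    and "assign A (b(i := \<lambda>j. if j < k then y else 0)) j = Some i"
proof -
  \<comment> \<open>\<open>r q z\<close> is the truthful report for value \<open>z\<close> and
    interest in exactly the first \<open>q\<close> items. \<open>E q\<close> has edges at buyer
    \<open>i\<close> only, since truthfulness lets the other bids in \<open>b\<close> be
    arbitrary.\<close>
  define r :: "nat \<Rightarrow> real \<Rightarrow> nat \<Rightarrow> real" where "r q z = (\<lambda>j. if j < q then z else 0)" for q z
  define E where "E q = {i} \<times> {..<q}" for q :: nat
  have prof: "b(i := r q z) \<in> bid_profiles n m" if "q \<le> m" "0 \<le> z" for q z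
    using bid_profiles_update[OF b i that] by (simp add: r_def)
  have mt: "matching {(i', j). (b(i := r q z)) i' j \<noteq> 0} (assign A (b(i := r q z)))"
    if "q \<le> m" "0 \<le> z" for q z
    using bspec[OF conjunct1[OF A(1)[unfolded online_mechanism_def]] prof[OF that]] .
  have declared: "j < q" if "assign A (b(i := r q z)) j = Some i" "q \<le> m" "0 \<le> z" for q z j
    using mt[OF that(2,3)] that(1) unfolding matching_def by (fastforce simp: r_def split: if_splits)
  have one_item: "j = j'"
    if "assign A (b(i := r q z)) j = Some i" "assign A (b(i := r q z)) j' = Some i" "q \<le> m" "0 \<le> z"
    for q z j j'
    using mt[OF that(3,4)] that(1,2) unfolding matching_def by (metis domI inj_onD)
  have mk: "market n m (\<lambda>_. z) (E q)" if "q \<le> m" "0 \<le> z" for q z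
    using that i unfolding market_def E_def by auto
  have tb: "r q z = truthful_bids (\<lambda>_. z) (E q) i" for q z
    unfolding r_def truthful_bids_def E_def by auto
  have dev: "utility (\<lambda>_. z) (E q) A (b(i := r q' z')) i \<le> utility (\<lambda>_. z) (E q) A (b(i := r q z)) i"
    if "q \<le> m" "0 \<le> z" "q' \<le> m" "0 \<le> z'" for q z q' z'
  proof -
    have "(b(i := r q z)) i = truthful_bids (\<lambda>_. z) (E q) i" by (simp add: tb)
    moreover have "(b(i := r q z))(i := r q' z') \<in> bid_profiles n m"
      using prof[OF that(3,4)] by simp
    ultimately show ?thesis
      using A(2) mk[OF that(1,2)] i prof[OF that(1,2)] unfolding truthful_def
      by (metis fun_upd_upd)
  qed
  have ir: "0 \<le> utility (\<lambda>_. z) (E q) A (b(i := r q z)) i" if "q \<le> m" "0 \<le> z" for q z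
  proof -
    have "(b(i := r q z)) i = truthful_bids (\<lambda>_. z) (E q) i" by (simp add: tb)
    then show ?thesis
      using A(3) mk[OF that] i prof[OF that] unfolding individually_rational_def by blast
  qed
  have pay0: "0 \<le> pay A (b(i := r q z)) i" if "q \<le> m" "0 \<le> z" for q z
    using A(1) prof[OF that] i unfolding online_mechanism_def by blast
  have served: "served (E q') (assign A (b(i := r q z))) i"
    if "assign A (b(i := r q z)) j = Some i" "j < q'" for q q' z j
    using that unfolding served_def E_def by auto
  have early: "\<exists>j'\<le>j. assign A (b(i := r k z')) j' = Some i"
    if wz: "assign A (b(i := r k z)) j = Some i" and p: "pay A (b(i := r k z)) i \<le> e"
      and z: "0 < z" "e < z'" for z z' j
  proof -
    have j: "Suc j \<le> k" using declared[OF wz k] z by simp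
    \<comment> \<open>Imitating \<open>r k z\<close> brings item \<open>j\<close> at a price of at
      most \<open>e < z'\<close>, so the truthful utility is positive. As payments are nonnegative,
      she must be served, by an item \<open>j' \<le> j\<close>; up to \<open>j'\<close> her bids
      coincide with those of \<open>r k z'\<close>.\<close>
    have "0 < utility (\<lambda>_. z') (E (Suc j)) A (b(i := r (Suc j) z')) i"
      using dev[of "Suc j" z' k z] served[OF wz, of "Suc j"] p k j z pos by (simp add: utility_def)
    then have "served (E (Suc j)) (assign A (b(i := r (Suc j) z'))) i"
      using pay0[of "Suc j" z'] k j z pos
      by (cases "served (E (Suc j)) (assign A (b(i := r (Suc j) z'))) i") (simp_all add: utility_def)
    then obtain j' where j': "assign A (b(i := r (Suc j) z')) j' = Some i" "j' \<le> j"
      unfolding served_def E_def by auto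
    have "\<forall>i'<n. \<forall>l\<le>j'. (b(i := r k z')) i' l = (b(i := r (Suc j) z')) i' l"
      using j' j by (auto simp: r_def)
    moreover have "j' < m" using j j' k by simp
    moreover have "b(i := r k z') \<in> bid_profiles n m" "b(i := r (Suc j) z') \<in> bid_profiles n m"
      using prof j k z pos by auto
    ultimately have "assign A (b(i := r k z')) j' = assign A (b(i := r (Suc j) z')) j'"
      using A(1) unfolding online_mechanism_def by blast
    then show ?thesis using j' by auto
  qed
  have win': "assign A (b(i := r k e)) l = Some i" using win by (simp add: r_def)
  have served_e: "served (E k) (assign A (b(i := r k e))) i"
    using served[OF win'] declared[OF win' k] pos by auto
  have pay_e: "pay A (b(i := r k e)) i \<le> e"
    using ir[of k e] served_e k pos by (simp add: utility_def)
  have pay_z: "pay A (b(i := r k z)) i \<le> e" if "assign A (b(i := r k z)) j = Some i" "e < z" for z j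
    using dev[of k z k e] served_e pay_e served[OF that(1), of k] declared[OF that(1) k] that k pos
    by (simp add: utility_def)
  \<comment> \<open>Applied to the win at \<open>e\<close>, \<open>early\<close> shows that
    \<open>x\<close> and \<open>y\<close> win at all. Applied to these two wins, it shows that
    neither item can come after the other.\<close>
  obtain jx jy where jx: "assign A (b(i := r k x)) jx = Some i"
    and jy: "assign A (b(i := r k y)) jy = Some i"
    using early[OF win' pay_e] pos by blast
  obtain jx' jy' where jx': "assign A (b(i := r k x)) jx' = Some i" "jx' \<le> jy"
    and jy': "assign A (b(i := r k y)) jy' = Some i" "jy' \<le> jx"
    using early[OF jx pay_z[OF jx]] early[OF jy pay_z[OF jy]] pos by (meson less_trans)
  have "jx' = jx" "jy' = jy"
    using one_item jx jx' jy jy' k pos by (meson less_imp_le less_trans)+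
  then have "jx = jy" using jx' jy' by simp
  then show thesis using that jx jy by (simp add: r_def)
qed


section \<open>Independent uniform draws\<close>

text \<open>Redrawing one coordinate keeps the distribution uniform: exchanging the new value with
  the old one is an involution on the pairs \<open>(w, a)\<close>.\<close>

lemma sum_PiE_resample:
  fixes F :: "('i \<Rightarrow> 'b) \<Rightarrow> real"
  assumes "i \<in> I"
  shows "(\<Sum>w\<in>I \<rightarrow>\<^sub>E S. \<Sum>a\<in>S. F (w(i := a))) = card S * (\<Sum>w\<in>I \<rightarrow>\<^sub>E S. F w)"
proof -
  let ?\<Omega> = "I \<rightarrow>\<^sub>E S" and ?h = "\<lambda>(w, a). (w(i := a), w i)"
  have "(\<Sum>w\<in>?\<Omega>. \<Sum>a\<in>S. F (w(i := a))) = (\<Sum>(w, a)\<in>?\<Omega> \<times> S. F (w(i := a)))"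
    by (rule sum.cartesian_product)
  also have "\<dots> = (\<Sum>(w, a)\<in>?\<Omega> \<times> S. F w)"
    by (rule sum.reindex_bij_witness[of _ ?h ?h])
      (use assms in \<open>auto simp: PiE_iff extensional_def\<close>)
  also have "\<dots> = (\<Sum>w\<in>?\<Omega>. \<Sum>a\<in>S. F w)"
    by (rule sum.cartesian_product[symmetric])
  finally show ?thesis by (simp add: sum_distrib_left)
qed

text \<open>
  The number \<open>X\<close> of hits is a sum of independent indicators with mean \<open>\<mu>\<close>, so that
  \<open>E X\<^sup>2 \<le> \<mu> + \<mu>\<^sup>2\<close>; the bound follows from \<open>min X \<mu> \<ge> X - X\<^sup>2 / (4 \<mu>)\<close>.
\<close>

lemma sum_min_hits_ge:
  assumes fin: "finite I" "finite S" and card: "card I = card S" "U \<subseteq> S" "U \<noteq> {}"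
  shows "real (card U) / 2 * card (I \<rightarrow>\<^sub>E S) \<le> (\<Sum>w\<in>I \<rightarrow>\<^sub>E S. real (min (card {i \<in> I. w i \<in> U}) (card U)))"
proof -
  define \<Omega> where "\<Omega> = (I \<rightarrow>\<^sub>E S)"
  define \<mu> where "\<mu> = real (card U)"
  define X where "X w = (\<Sum>i\<in>I. of_bool (w i \<in> U) :: real)" for w
  have finU: "finite U" using fin card finite_subset by blast
  have \<mu>: "1 \<le> \<mu>" using card finU unfolding \<mu>_def by (simp add: Suc_le_eq card_gt_0_iff)
  have N: "0 < card S" using card fin by (auto simp: card_gt_0_iff)
  have X_card: "real (card {i \<in> I. w i \<in> U}) = X w" for w
    using fin unfolding X_def by (simp add: sum_of_bool_eq Int_def)
  have \<mu>_sum: "(\<Sum>a\<in>S. of_bool (a \<in> U)) = \<mu>"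
    using fin card unfolding \<mu>_def by (simp add: sum_of_bool_eq Int_absorb1)
  have X_upd: "X (w(i := a)) \<le> X w + 1" if "i \<in> I" for w i a
  proof -
    have "X (w(i := a)) \<le> (\<Sum>l\<in>I. of_bool (w l \<in> U) + of_bool (l = i))"
      unfolding X_def by (rule sum_mono) auto
    also have "\<dots> = X w + 1"
      using fin that unfolding X_def sum.distrib by (simp add: sum_of_bool_eq Int_absorb1)
    finally show ?thesis .
  qed
  have X1: "(\<Sum>w\<in>\<Omega>. X w) = \<mu> * card \<Omega>"
  proof -
    have "(\<Sum>w\<in>\<Omega>. X w) = (\<Sum>i\<in>I. \<Sum>w\<in>\<Omega>. of_bool (w i \<in> U))"
      unfolding X_def by (rule sum.swap)
    also have "\<dots> = (\<Sum>i\<in>I. \<mu> * card \<Omega> / card S)"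
    proof (rule sum.cong[OF refl])
      fix i assume "i \<in> I"
      from sum_PiE_resample[OF this, of "\<lambda>w. of_bool (w i \<in> U)" S]
      show "(\<Sum>w\<in>\<Omega>. of_bool (w i \<in> U)) = \<mu> * card \<Omega> / card S"
        using N by (simp add: \<Omega>_def[symmetric] \<mu>_sum field_simps)
    qed
    finally show ?thesis using N card by simp
  qed
  \<comment> \<open>Write the square as a sum over \<open>i\<close> of the indicator of a hit at
    \<open>i\<close> times \<open>X\<close>, and redraw coordinate \<open>i\<close>. The indicator
    then depends on \<open>a\<close> alone, and \<open>X\<close> has grown by at most one.\<close>
  have X2: "(\<Sum>w\<in>\<Omega>. (X w)\<^sup>2) \<le> \<mu> * (\<mu> * card \<Omega> + card \<Omega>)"
  proof -
    have "(\<Sum>w\<in>\<Omega>. (X w)\<^sup>2) = (\<Sum>w\<in>\<Omega>. \<Sum>i\<in>I. of_bool (w i \<in> U) * X w)"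
      by (simp add: power2_eq_square sum_distrib_right[symmetric]) (simp add: X_def)
    also have "\<dots> = (\<Sum>i\<in>I. \<Sum>w\<in>\<Omega>. of_bool (w i \<in> U) * X w)"
      by (rule sum.swap)
    also have "\<dots> \<le> (\<Sum>i\<in>I. \<mu> * (\<mu> * card \<Omega> + card \<Omega>) / card S)"
    proof (rule sum_mono)
      fix i assume i: "i \<in> I"
      have "card S * (\<Sum>w\<in>\<Omega>. of_bool (w i \<in> U) * X w)
          = (\<Sum>w\<in>\<Omega>. \<Sum>a\<in>S. of_bool (a \<in> U) * X (w(i := a)))"
        using sum_PiE_resample[OF i, of "\<lambda>w. of_bool (w i \<in> U) * X w" S] by (simp add: \<Omega>_def)
      also have "\<dots> \<le> (\<Sum>w\<in>\<Omega>. \<Sum>a\<in>S. of_bool (a \<in> U) * (X w + 1))"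
        by (intro sum_mono mult_left_mono X_upd i) auto
      also have "\<dots> = \<mu> * (\<mu> * card \<Omega> + card \<Omega>)"
        by (simp add: sum_distrib_right[symmetric] \<mu>_sum sum_distrib_left[symmetric] sum.distrib X1)
      finally show "(\<Sum>w\<in>\<Omega>. of_bool (w i \<in> U) * X w) \<le> \<mu> * (\<mu> * card \<Omega> + card \<Omega>) / card S"
        using N by (simp add: field_simps)
    qed
    finally show ?thesis using N card by simp
  qed
  \<comment> \<open>The constant 4 makes the parabola peak at \<open>x = 2 * \<mu>\<close> with
    height exactly \<open>\<mu>\<close>.\<close>
  have min_ge: "x - x\<^sup>2 / (4 * \<mu>) \<le> min x \<mu>" for x
  proof -
    have "0 \<le> (x - 2 * \<mu>)\<^sup>2 / (4 * \<mu>)" using \<mu> by simp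
    also have "\<dots> = \<mu> - (x - x\<^sup>2 / (4 * \<mu>))"
      using \<mu> by (simp add: power2_eq_square field_simps)
    finally show ?thesis using \<mu> by simp
  qed
  \<comment> \<open>Per draw this reads \<open>\<mu> / 2 \<le> (3 * \<mu> - 1) / 4\<close>, which is
    \<open>1 \<le> \<mu>\<close>: here \<open>U\<close> has to be nonempty.\<close>
  have "\<mu> / 2 * card \<Omega> \<le> \<mu> * card \<Omega> - \<mu> * (\<mu> * card \<Omega> + card \<Omega>) / (4 * \<mu>)"
  proof -
    have "\<mu> * card \<Omega> - \<mu> * (\<mu> * card \<Omega> + card \<Omega>) / (4 * \<mu>) - \<mu> / 2 * card \<Omega> = (\<mu> - 1) / 4 * card \<Omega>"
      using \<mu> by (simp add: field_simps)
    also have "\<dots> \<ge> 0" using \<mu> by simp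
    finally show ?thesis by simp
  qed
  also have "\<dots> \<le> (\<Sum>w\<in>\<Omega>. X w) - (\<Sum>w\<in>\<Omega>. (X w)\<^sup>2) / (4 * \<mu>)"
    unfolding X1 using \<mu> by (intro diff_left_mono divide_right_mono X2) simp
  also have "\<dots> = (\<Sum>w\<in>\<Omega>. X w - (X w)\<^sup>2 / (4 * \<mu>))"
    by (simp add: sum_subtractf sum_divide_distrib)
  also have "\<dots> \<le> (\<Sum>w\<in>\<Omega>. min (X w) \<mu>)"
    by (intro sum_mono min_ge)
  finally show ?thesis
    by (simp add: \<Omega>_def \<mu>_def X_card[symmetric] of_nat_min)
qed

section \<open>Phases of items and levels of values\<close>

text \<open>
  The map \<open>phase\<close> serves two purposes: it gives the phase in which an item arrives, and applied to a
  uniform random number below \<open>items_before K K\<close> it gives the random level of a buyer's value.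
\<close>

definition items_before :: "nat \<Rightarrow> nat \<Rightarrow> nat" where
  "items_before K t = (\<Sum>s<t. K ^ s)"

definition phase :: "nat \<Rightarrow> nat \<Rightarrow> nat" where
  "phase K j = (LEAST t. j < items_before K (Suc t))"

text \<open>A buyer is at level \<open>t\<close> with probability proportional to
  \<open>K ^ t\<close>, the supply of phase \<open>t\<close>. The base \<open>2 / K\<close> makes
  \<open>K ^ t\<close> such values worth \<open>2 ^ t\<close> together.\<close>

definition phase_value :: "nat \<Rightarrow> nat \<Rightarrow> real" where
  "phase_value K t = (2 / real K) ^ t"

lemma items_before_mono: "s \<le> t \<Longrightarrow> items_before K s \<le> items_before K t"
  unfolding items_before_def by (rule sum_mono2) auto

text \<open>Ensures that every index has a phase, so that the \<open>LEAST\<close> in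
  \<open>phase\<close> exists.\<close>

lemma le_items_before: "1 \<le> K \<Longrightarrow> t \<le> items_before K t"
  unfolding items_before_def
proof (induction t)
  case (Suc t)
  have "1 \<le> K ^ t" using Suc.prems by simp
  then have "Suc t \<le> (\<Sum>s<t. K ^ s) + K ^ t" using Suc.IH[OF Suc.prems] by linarith
  then show ?case by simp
qed simp

lemma phase_le_iff:
  assumes "1 \<le> K"
  shows "phase K j \<le> t \<longleftrightarrow> j < items_before K (Suc t)"
proof
  have "j < items_before K (Suc j)" using le_items_before[OF assms, of "Suc j"] by simp
  then have "j < items_before K (Suc (phase K j))" unfolding phase_def by (rule LeastI)
  then show "j < items_before K (Suc t)" if "phase K j \<le> t"
    using items_before_mono[of "Suc (phase K j)" "Suc t" K] that by simp
qed (auto simp: phase_def intro: Least_le)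

lemma phase_less_iff:
  assumes "1 \<le> K"
  shows "phase K j < t \<longleftrightarrow> j < items_before K t"
proof (cases t)
  case 0
  then show ?thesis by (simp add: items_before_def)
next
  case (Suc t')
  then show ?thesis using phase_le_iff[OF assms, of j t'] by (simp only: less_Suc_eq_le)
qed

lemma card_phase:
  assumes "1 \<le> K" "t < K"
  shows "card {j. j < items_before K K \<and> phase K j = t} = K ^ t"
proof -
  have "j < items_before K K \<and> phase K j = t \<longleftrightarrow> j < items_before K (Suc t) \<and> \<not> j < items_before K t" for j
    unfolding phase_less_iff[OF assms(1), symmetric] using assms(2) by auto
  then have "{j. j < items_before K K \<and> phase K j = t} = {..<items_before K (Suc t)} - {..<items_before K t}"
    by (intro set_eqI) (simp only: mem_Collect_eq Diff_iff lessThan_iff)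
  then show ?thesis
    using items_before_mono[of t "Suc t" K] by (simp add: card_Diff_subset) (simp add: items_before_def)
qed

text \<open>Serves for sums over items as well as for sums over the possible draws of one
  buyer.\<close>

lemma sum_phase:
  fixes f :: "nat \<Rightarrow> real"
  assumes "1 \<le> K"
  shows "(\<Sum>j<items_before K K. f (phase K j)) = (\<Sum>t<K. real K ^ t * f t)"
proof -
  have "(\<Sum>j<items_before K K. f (phase K j)) = (\<Sum>t<K. \<Sum>j | j \<in> {..<items_before K K} \<and> phase K j = t. f (phase K j))"
    by (rule sum.group[symmetric]) (auto simp: phase_less_iff[OF assms])
  also have "\<dots> = (\<Sum>t<K. real K ^ t * f t)"
    by (rule sum.cong) (use card_phase[OF assms] in auto)
  finally show ?thesis .
qed

text \<open>A sale in phase \<open>p\<close> counts for every stopping time from \<open>p\<close>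
  on; this is its total weight.\<close>

lemma sum_half_powers_from:
  "(\<Sum>t<k. of_bool (p \<le> t) * (1 / 2 :: real) ^ t) \<le> 2 * (1 / 2) ^ p"
proof -
  have "(\<Sum>t<k. of_bool (p \<le> t) * (1 / 2 :: real) ^ t) = (if p \<le> k then 2 * (1 / 2) ^ p - 2 * (1 / 2) ^ k else 0)"
    by (induction k) (auto simp: le_Suc_eq)
  then show ?thesis by simp
qed

lemma sum_two_powers_upto:
  "(\<Sum>t<k. of_bool (t \<le> q) * (2 :: real) ^ t) \<le> 2 * 2 ^ q"
proof -
  have "(\<Sum>t<k. of_bool (t \<le> q) * (2 :: real) ^ t) = (if k \<le> q then 2 ^ k else 2 * 2 ^ q) - 1"
  proof (induction k)
    case (Suc k)
    consider "Suc k \<le> q" | "k = q" | "q < k" by linarith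
    then show ?case using Suc by cases simp_all
  qed simp
  also have "\<dots> \<le> 2 * 2 ^ q"
    by (smt (verit) power_increasing zero_le_power)
  finally show ?thesis .
qed


section \<open>Bounds on the weighted gain of the mechanism\<close>

lemma phase_value_mult:
  assumes "1 \<le> K"
  shows "real K ^ t * phase_value K t = 2 ^ t"
  using assms unfolding phase_value_def by (simp flip: power_mult_distrib)

text \<open>
  Here \<open>win a j\<close> means that the buyer wins item \<open>j\<close> when her value is drawn as \<open>a\<close>.  The lowest winning
  level \<open>p\<close> is exceptional, as the item is not determined there; it contributes \<open>1\<close> only.
\<close>

lemma buyer_gain_le:
  fixes win :: "nat \<Rightarrow> nat \<Rightarrow> bool"
  assumes K: "1 \<le> K"
    and one_item: "\<And>a j j'. win a j \<Longrightarrow> win a j' \<Longrightarrow> j = j'"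
    and same_item: "\<And>e a c j l. phase K a < phase K e \<Longrightarrow> phase K c < phase K e \<Longrightarrow>
      win e l \<Longrightarrow> win a j \<Longrightarrow> win c j"
  defines "N \<equiv> items_before K K"
  shows "(\<Sum>a<N. \<Sum>j<N. of_bool (win a j \<and> phase K a \<le> phase K j) * (phase_value K (phase K a) * (1 / 2) ^ phase K j)) \<le> 3"
    (is "(\<Sum>a<N. \<Sum>j<N. ?f a j) \<le> 3")
proof -
  define W where "W = {a. a < N \<and> (\<exists>j. win a j)}"
  \<comment> \<open>Values decrease with the level, so the lowest winning value has the largest
    level.\<close>
  define p where "p = Max (phase K ` W)"
  have p_ge: "phase K a \<le> p" if "a \<in> W" for a
    unfolding p_def using that by (simp add: W_def)
  \<comment> \<open>A win at level \<open>p\<close> plays the part of \<open>e\<close> in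
    \<open>same_item\<close>: all draws of smaller level win one common item, and \<open>q\<close>
    is its phase.\<close>
  have "\<exists>q. \<forall>a\<in>W. \<forall>j. phase K a < p \<longrightarrow> win a j \<longrightarrow> phase K j = q"
  proof (cases "\<exists>a\<in>W. phase K a < p")
    case True
    then obtain a j where a: "a \<in> W" "phase K a < p" "win a j" by (auto simp: W_def)
    then have "p \<in> phase K ` W" unfolding p_def by (intro Max_in) (auto simp: W_def)
    then obtain e l where e: "win e l" "phase K e = p" by (auto simp: W_def)
    have "j' = j" if "c \<in> W" "phase K c < p" "win c j'" for c j'
      using same_item[of a e c l j] one_item[of c j j'] a e that by simp
    then show ?thesis by blast
  next
    case False
    then show ?thesis by blast
  qed
  then obtain q where q: "\<forall>a\<in>W. \<forall>j. phase K a < p \<longrightarrow> win a j \<longrightarrow> phase K j = q" ..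
  \<comment> \<open>At level \<open>p\<close> only \<open>p \<le> phase K j\<close> is known, so the
    weight is at most \<open>(1 / 2) ^ p\<close>; after multiplication by \<open>K ^ p\<close> this
    costs 1. The other winning levels are at most \<open>q\<close> and share the weight
    \<open>(1 / 2) ^ q\<close>; a geometric sum bounds them by 2.\<close>
  define g where "g t = of_bool (t = p) * (phase_value K t * (1 / 2) ^ t)
      + of_bool (t \<le> q) * (phase_value K t * (1 / 2) ^ q)" for t
  have val: "0 \<le> phase_value K t" for t unfolding phase_value_def by simp
  have g: "0 \<le> g t" for t unfolding g_def using val by simp
  have "(\<Sum>j<N. ?f a j) \<le> g (phase K a)" if a: "a < N" for a
  proof (cases "\<exists>j. win a j")
    case True
    then obtain j where j: "win a j" by blast
    have W: "a \<in> W" using a True by (simp add: W_def)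
    have "(\<Sum>j'<N. ?f a j') \<le> (\<Sum>j'<N. if j' = j then ?f a j else 0)"
      by (rule sum_mono) (use one_item[OF j] in auto)
    also have "\<dots> \<le> ?f a j" using val by simp
    also have "\<dots> \<le> g (phase K a)"
    proof (cases "phase K a = p")
      case True
      have "?f a j \<le> of_bool True * (phase_value K (phase K a) * (1 / 2) ^ phase K a)"
        using val by (auto intro!: mult_left_mono power_decreasing)
      then show ?thesis using True val unfolding g_def by (simp add: add_increasing2)
    next
      case False
      then have "phase K a < p" using p_ge[OF W] by simp
      then have "phase K j = q" using q W j by blast
      then show ?thesis using False j by (simp add: g_def)
    qed
    finally show ?thesis .
  qed (simp add: g)
  then have "(\<Sum>a<N. \<Sum>j<N. ?f a j) \<le> (\<Sum>a<N. g (phase K a))"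
    by (intro sum_mono) simp
  also have "\<dots> = (\<Sum>t<K. real K ^ t * g t)"
    unfolding N_def by (rule sum_phase[OF K])
  also have "\<dots> = (\<Sum>t<K. of_bool (t = p) + of_bool (t \<le> q) * 2 ^ t * (1 / 2) ^ q)"
  proof (rule sum.cong[OF refl])
    fix t
    have "real K ^ t * g t = of_bool (t = p) * ((real K ^ t * phase_value K t) * (1 / 2) ^ t)
      + of_bool (t \<le> q) * ((real K ^ t * phase_value K t) * (1 / 2) ^ q)"
      unfolding g_def by (simp add: algebra_simps)
    then show "real K ^ t * g t = of_bool (t = p) + of_bool (t \<le> q) * 2 ^ t * (1 / 2) ^ q"
      by (simp add: phase_value_mult[OF K] power_divide)
  qed
  also have "\<dots> = (\<Sum>t<K. of_bool (t = p)) + (\<Sum>t<K. of_bool (t \<le> q) * 2 ^ t) * (1 / 2) ^ q"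
    unfolding sum.distrib sum_distrib_right ..
  also have "\<dots> \<le> 1 + 2 * 2 ^ q * (1 / 2) ^ q"
    by (intro add_mono mult_right_mono sum_two_powers_upto) (auto simp: sum_of_bool_eq card_le_Suc0_iff_eq)
  also have "\<dots> = 3" by (simp add: power_divide)
  finally show ?thesis .
qed

text \<open>Each of the \<open>K ^ t\<close> items of phase \<open>t\<close> has at most one winner,
  whose value here is at most that of level \<open>Suc t\<close>. With weight
  \<open>(1 / 2) ^ t\<close> a phase yields at most \<open>2 / K\<close>, and there are
  \<open>K\<close> phases.\<close>

lemma supply_gain_le:
  fixes win :: "nat \<Rightarrow> nat \<Rightarrow> bool" and level :: "nat \<Rightarrow> nat"
  assumes K: "2 \<le> K" and one_buyer: "\<And>i i' j. win i j \<Longrightarrow> win i' j \<Longrightarrow> i = i'"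
  defines "N \<equiv> items_before K K"
  shows "(\<Sum>i<N. \<Sum>j<N. of_bool (win i j \<and> phase K j < level i) * (phase_value K (level i) * (1 / 2) ^ phase K j)) \<le> 2"
    (is "(\<Sum>i<N. \<Sum>j<N. ?f i j) \<le> 2")
proof -
  have val: "0 \<le> phase_value K t" for t unfolding phase_value_def by simp
  have K1: "1 \<le> K" using K by simp
  let ?g = "\<lambda>t. phase_value K (Suc t) * (1 / 2) ^ t"
  have "(\<Sum>i<N. \<Sum>j<N. ?f i j) = (\<Sum>j<N. \<Sum>i<N. ?f i j)" by (rule sum.swap)
  also have "\<dots> \<le> (\<Sum>j<N. ?g (phase K j))"
  proof (rule sum_mono)
    fix j
    have "(\<Sum>i<N. ?f i j) \<le> (\<Sum>i<N. of_bool (win i j) * ?g (phase K j))"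
    proof (rule sum_mono)
      fix i
      have "phase_value K (level i) \<le> phase_value K (Suc (phase K j))" if "phase K j < level i"
        unfolding phase_value_def by (rule power_decreasing) (use K that in auto)
      then show "?f i j \<le> of_bool (win i j) * ?g (phase K j)"
        using val by (auto intro!: mult_right_mono)
    qed
    also have "\<dots> = real (card {i \<in> {..<N}. win i j}) * ?g (phase K j)"
      by (simp add: sum_distrib_right[symmetric] sum_of_bool_eq Int_def)
    also have "\<dots> \<le> 1 * ?g (phase K j)"
      using val one_buyer[of _ j] by (intro mult_right_mono) (auto simp: card_le_Suc0_iff_eq)
    finally show "(\<Sum>i<N. ?f i j) \<le> ?g (phase K j)" by simp
  qed
  also have "\<dots> = (\<Sum>t<K. real K ^ t * ?g t)"
    unfolding N_def by (rule sum_phase[OF K1])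
  also have "\<dots> = (\<Sum>t<K. 2 / real K)"
  proof (rule sum.cong[OF refl])
    fix t
    have "real K ^ t * ?g t = (real K ^ t * phase_value K t) * (1 / 2) ^ t * (2 / real K)"
      unfolding phase_value_def by simp
    then show "real K ^ t * ?g t = 2 / real K"
      by (simp add: phase_value_mult[OF K1] power_divide)
  qed
  also have "\<dots> = 2" using K by simp
  finally show ?thesis .
qed

text \<open>Sales are split by whether the phase of the item is below the level of the buyer. The
  sales below it gain at most 2 for every \<open>w\<close>. For the others, redrawing the level of
  one buyer gives \<open>3 / N\<close> on average, hence 3 for all \<open>N\<close> buyers. Summing
  over stopping times costs a factor of 2, which gives 10.\<close>

lemma weighted_gain_le:
  fixes win :: "(nat \<Rightarrow> nat) \<Rightarrow> nat \<Rightarrow> nat \<Rightarrow> bool"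
  assumes K: "2 \<le> K"
  defines "N \<equiv> items_before K K"
  defines "\<Omega> \<equiv> {..<N} \<rightarrow>\<^sub>E {..<N}"
  assumes one_item: "\<And>w i j j'. win w i j \<Longrightarrow> win w i j' \<Longrightarrow> j = j'"
    and one_buyer: "\<And>w i i' j. win w i j \<Longrightarrow> win w i' j \<Longrightarrow> i = i'"
    and same_item: "\<And>w i e a c j l. w \<in> \<Omega> \<Longrightarrow> i < N \<Longrightarrow> phase K a < phase K e \<Longrightarrow> phase K c < phase K e \<Longrightarrow>
      win (w(i := e)) i l \<Longrightarrow> win (w(i := a)) i j \<Longrightarrow> win (w(i := c)) i j"
  shows "(\<Sum>w\<in>\<Omega>. \<Sum>t<K. (1 / 2) ^ t * (\<Sum>i<N. phase_value K (phase K (w i)) *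
      of_bool (\<exists>j<items_before K (Suc t). win w i j))) \<le> 10 * real (card \<Omega>)"
proof -
  have K1: "1 \<le> K" using K by simp
  have N: "0 < N" using le_items_before[OF K1, of K] K unfolding N_def by simp
  have val: "0 \<le> phase_value K t" for t unfolding phase_value_def by simp
  define early where "early w i = (\<Sum>j<N. of_bool (win w i j \<and> phase K j < phase K (w i)) *
      (phase_value K (phase K (w i)) * (1 / 2) ^ phase K j))" for w i
  define late where "late w i = (\<Sum>j<N. of_bool (win w i j \<and> phase K (w i) \<le> phase K j) *
      (phase_value K (phase K (w i)) * (1 / 2) ^ phase K j))" for w i
  have gain: "(\<Sum>t<K. (1 / 2 :: real) ^ t * of_bool (\<exists>j<items_before K (Suc t). win w i j))
      \<le> (\<Sum>j<N. of_bool (win w i j) * (2 * (1 / 2) ^ phase K j))" (is "?l \<le> _") for w i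
  proof -
    have "?l \<le> (\<Sum>t<K. (1 / 2) ^ t * (\<Sum>j<N. of_bool (win w i j) * of_bool (phase K j \<le> t)))"
    proof (intro sum_mono mult_left_mono)
      fix t assume t: "t \<in> {..<K}"
      show "of_bool (\<exists>j<items_before K (Suc t). win w i j)
          \<le> (\<Sum>j<N. of_bool (win w i j) * of_bool (phase K j \<le> t) :: real)"
      proof (cases "\<exists>j<items_before K (Suc t). win w i j")
        case True
        then obtain j where j: "j < items_before K (Suc t)" "win w i j" by blast
        then have "phase K j \<le> t" "j < N"
          using phase_le_iff[OF K1, of j t] items_before_mono[of "Suc t" K K] t unfolding N_def by auto
        then have "(1 :: real) \<le> (\<Sum>j\<in>{j}. of_bool (win w i j) * of_bool (phase K j \<le> t))"
          using j by simp
        also have "\<dots> \<le> (\<Sum>j<N. of_bool (win w i j) * of_bool (phase K j \<le> t))"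
          by (rule sum_mono2) (use \<open>j < N\<close> in auto)
        finally show ?thesis using True by simp
      next
        case False
        then have "of_bool (\<exists>j<items_before K (Suc t). win w i j) = (0 :: real)" by simp
        then show ?thesis by (simp only:) (intro sum_nonneg, simp)
      qed
    qed simp
    also have "\<dots> = (\<Sum>t<K. \<Sum>j<N. of_bool (win w i j) * (of_bool (phase K j \<le> t) * (1 / 2) ^ t))"
      unfolding sum_distrib_left by (intro sum.cong refl) (simp only: mult_ac)
    also have "\<dots> = (\<Sum>j<N. of_bool (win w i j) * (\<Sum>t<K. of_bool (phase K j \<le> t) * (1 / 2) ^ t))"
      unfolding sum_distrib_left by (rule sum.swap)
    also have "\<dots> \<le> (\<Sum>j<N. of_bool (win w i j) * (2 * (1 / 2) ^ phase K j))"
      by (intro sum_mono mult_left_mono sum_half_powers_from) simp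
    finally show ?thesis .
  qed
  have "(\<Sum>t<K. (1 / 2) ^ t * (\<Sum>i<N. phase_value K (phase K (w i)) *
      of_bool (\<exists>j<items_before K (Suc t). win w i j)))
    \<le> 2 * ((\<Sum>i<N. early w i) + (\<Sum>i<N. late w i))" (is "?l \<le> _") for w
  proof -
    have "?l = (\<Sum>i<N. phase_value K (phase K (w i)) *
        (\<Sum>t<K. (1 / 2) ^ t * of_bool (\<exists>j<items_before K (Suc t). win w i j)))"
      unfolding sum_distrib_left by (subst sum.swap) (simp only: mult_ac)
    also have "\<dots> \<le> (\<Sum>i<N. phase_value K (phase K (w i)) *
        (\<Sum>j<N. of_bool (win w i j) * (2 * (1 / 2) ^ phase K j)))"
      by (intro sum_mono mult_left_mono gain val)
    also have "\<dots> = (\<Sum>i<N. 2 * (early w i + late w i))"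
      unfolding early_def late_def sum.distrib[symmetric] sum_distrib_left
      by (intro sum.cong refl) auto
    finally show ?thesis by (simp add: sum_distrib_left sum.distrib)
  qed
  then have "(\<Sum>w\<in>\<Omega>. \<Sum>t<K. (1 / 2) ^ t * (\<Sum>i<N. phase_value K (phase K (w i)) *
      of_bool (\<exists>j<items_before K (Suc t). win w i j)))
    \<le> (\<Sum>w\<in>\<Omega>. 2 * ((\<Sum>i<N. early w i) + (\<Sum>i<N. late w i)))"
    by (rule sum_mono)
  also have "\<dots> = 2 * ((\<Sum>w\<in>\<Omega>. \<Sum>i<N. early w i) + (\<Sum>w\<in>\<Omega>. \<Sum>i<N. late w i))"
    by (simp add: sum_distrib_left sum.distrib)
  also have "\<dots> \<le> 2 * ((\<Sum>w\<in>\<Omega>. 2) + 3 * real (card \<Omega>))"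
  proof (intro mult_left_mono add_mono sum_mono)
    show "(\<Sum>i<N. early w i) \<le> 2" for w
      unfolding early_def N_def by (rule supply_gain_le[OF K one_buyer])
    have late: "(\<Sum>w\<in>\<Omega>. late w i) \<le> 3 * card \<Omega> / N" if i: "i < N" for i
    proof -
      have "N * (\<Sum>w\<in>\<Omega>. late w i) = (\<Sum>w\<in>\<Omega>. \<Sum>a<N. late (w(i := a)) i)"
        using sum_PiE_resample[of i "{..<N}" "\<lambda>w. late w i" "{..<N}"] i by (simp add: \<Omega>_def)
      also have "\<dots> \<le> (\<Sum>w\<in>\<Omega>. 3)"
      proof (rule sum_mono)
        fix w assume w: "w \<in> \<Omega>"
        show "(\<Sum>a<N. late (w(i := a)) i) \<le> 3"
          unfolding late_def N_def fun_upd_same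
          by (rule buyer_gain_le[OF K1]) (fact one_item, fact same_item[OF w i])
      qed
      finally show ?thesis using N by (simp add: field_simps)
    qed
    have "(\<Sum>w\<in>\<Omega>. \<Sum>i<N. late w i) = (\<Sum>i<N. \<Sum>w\<in>\<Omega>. late w i)" by (rule sum.swap)
    also have "\<dots> \<le> (\<Sum>i<N. 3 * card \<Omega> / N)" by (intro sum_mono late) simp
    finally show "(\<Sum>w\<in>\<Omega>. \<Sum>i<N. late w i) \<le> 3 * real (card \<Omega>)" using N by simp
  qed simp
  finally show ?thesis by simp
qed


section \<open>The hard instances\<close>

lemma items_before_le_power:
  assumes "2 \<le> K"
  shows "items_before K t \<le> K ^ t"
  unfolding items_before_def
proof (induction t)
  case (Suc t)
  have "(\<Sum>s<Suc t. K ^ s) \<le> 2 * K ^ t" using Suc by simp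
  also have "\<dots> \<le> K * K ^ t" using assms by (rule mult_right_mono) simp
  finally show ?case by simp
qed simp

lemma truthful_bids_in_bid_profiles:
  assumes "market n m v E" and nonneg: "\<And>i. 0 \<le> v i"
  shows "truthful_bids v E \<in> bid_profiles n m"
proof -
  have "\<exists>x\<ge>0. \<forall>j. truthful_bids v E i j = 0 \<or> truthful_bids v E i j = x" for i
    using nonneg[of i] by (auto simp: truthful_bids_def intro!: exI[of _ "v i"])
  then show ?thesis
    using assms(1) unfolding bid_profiles_def market_def
    by (auto simp: truthful_bids_def split: if_splits)
qed

definition level_values :: "nat \<Rightarrow> (nat \<Rightarrow> nat) \<Rightarrow> nat \<Rightarrow> real" where
  "level_values K w i = phase_value K (phase K (w i))"

text \<open>Stopping after phase \<open>t\<close> means that nobody wants the later items, so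
  \<open>n\<close> and \<open>m\<close> stay fixed. Surplus buyers have no edges; their values in
  \<open>level_values\<close> come from \<open>w\<close> outside its domain and do no harm.\<close>

definition level_graph :: "nat \<Rightarrow> nat \<Rightarrow> (nat \<times> nat) set" where
  "level_graph K t = {..<items_before K K} \<times> {..<items_before K (Suc t)}"

lemma level_values_nonneg: "0 \<le> level_values K w i"
  by (simp add: level_values_def phase_value_def)

lemma market_level:
  assumes "items_before K K \<le> n" "items_before K K \<le> m" "t < K"
  shows "market n m (level_values K w) (level_graph K t)"
  using assms items_before_mono[of "Suc t" K K] level_values_nonneg
  unfolding market_def level_graph_def by auto

lemma level_bids_in_bid_profiles:
  assumes "items_before K K \<le> n" "items_before K K \<le> m" "t < K"
  shows "truthful_bids (level_values K w) (level_graph K t) \<in> bid_profiles n m"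
  using truthful_bids_in_bid_profiles[OF market_level[OF assms] level_values_nonneg] .

text \<open>Up to the end of phase \<open>t\<close> the stopped instance has the same bids as the
  full one, so an online mechanism assigns these items equally in both. A single relation
  \<open>win\<close>, read off the full run, thus describes all stopping times.\<close>

lemma weighted_welfare_le:
  assumes A: "online_mechanism n m A" "truthful n m A" "individually_rational n m A"
    and K: "3 \<le> K" and n: "items_before K K \<le> n" and m: "items_before K K \<le> m"
  defines "\<Omega> \<equiv> {..<items_before K K} \<rightarrow>\<^sub>E {..<items_before K K}"
  shows "(\<Sum>w\<in>\<Omega>. \<Sum>t<K. (1 / 2) ^ t *
      welfare n (level_values K w) (level_graph K t)
        (assign A (truthful_bids (level_values K w) (level_graph K t)))) \<le> 10 * real (card \<Omega>)"
proof -
  define N where "N = items_before K K"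
  define b where "b w = truthful_bids (level_values K w) (level_graph K (K - 1))" for w
  define win where "win w i j \<longleftrightarrow> assign A (b w) j = Some i" for w i j
  have K1: "1 \<le> K" "K - 1 < K" "Suc (K - 1) = K" using K by auto
  have b: "b w \<in> bid_profiles n m" for w
    unfolding b_def using level_bids_in_bid_profiles[OF n m K1(2)] .
  have b_upd: "b (w(i := a)) = (b w)(i := \<lambda>j. if j < N then phase_value K (phase K a) else 0)"
    if "i < N" for w i a
    using that K1(3) unfolding b_def truthful_bids_def level_graph_def level_values_def N_def
    by (auto simp: fun_eq_iff)
  have matching: "matching {(i, j). b w i j \<noteq> 0} (assign A (b w))" for w
    using bspec[OF conjunct1[OF A(1)[unfolded online_mechanism_def]] b] .
  have one_item: "j = j'" if "win w i j" "win w i j'" for w i j j'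
    using matching[of w] that unfolding matching_def win_def by (metis domI inj_onD)
  have one_buyer: "i = i'" if "win w i j" "win w i' j" for w i i' j
    using that unfolding win_def by simp
  \<comment> \<open>Here \<open>K \<ge> 3\<close> enters: the base \<open>2 / K\<close> must be
    strictly below 1.\<close>
  have value_less: "phase_value K t < phase_value K s" if "s < t" for s t
    unfolding phase_value_def by (rule power_strict_decreasing[OF that]) (use K in auto)
  have same_item: "win (w(i := c)) i j"
    if i: "i < N" and less: "phase K a < phase K e" "phase K c < phase K e"
      and win: "win (w(i := e)) i l" "win (w(i := a)) i j" for w i e a c j l
  proof -
    have "0 < phase_value K (phase K e)" using K by (simp add: phase_value_def)
    moreover have "i < n" using i n unfolding N_def by simp
    moreover have "assign A ((b w)(i := \<lambda>j. if j < N then phase_value K (phase K e) else 0)) l = Some i"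
      using win(1) unfolding win_def b_upd[OF i] .
    ultimately obtain j' where "win (w(i := a)) i j'" "win (w(i := c)) i j'"
      using higher_bids_win_same_item[OF A b _ m[folded N_def] _ value_less[OF less(1)] value_less[OF less(2)]]
      unfolding win_def b_upd[OF i] by blast
    then show ?thesis using one_item[OF win(2)] by simp
  qed
  have "welfare n (level_values K w) (level_graph K t)
        (assign A (truthful_bids (level_values K w) (level_graph K t)))
    \<le> (\<Sum>i<N. level_values K w i * of_bool (\<exists>j<items_before K (Suc t). win w i j))"
    if t: "t < K" for w t
  proof -
    define b' where "b' = truthful_bids (level_values K w) (level_graph K t)"
    have t_le: "items_before K (Suc t) \<le> N"
      unfolding N_def using t by (intro items_before_mono) simp
    have same: "assign A b' j = assign A (b w) j" if j: "j < items_before K (Suc t)" for j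
    proof -
      have "\<forall>i<n. \<forall>k\<le>j. b' i k = b w i k"
        using j t_le K1(3) unfolding b'_def b_def truthful_bids_def level_graph_def N_def by auto
      moreover have "b' \<in> bid_profiles n m"
        unfolding b'_def using level_bids_in_bid_profiles[OF n m t] .
      moreover have "j < m" using j t_le m unfolding N_def by simp
      ultimately show ?thesis using A(1) b[of w] unfolding online_mechanism_def by blast
    qed
    have "welfare n (level_values K w) (level_graph K t) (assign A b')
        = (\<Sum>i<n. level_values K w i * of_bool (i < N \<and> (\<exists>j<items_before K (Suc t). win w i j)))"
      unfolding welfare_def
    proof (intro sum.cong refl arg_cong2[of _ _ _ _ "(*)"] arg_cong[of _ _ of_bool])
      fix i
      show "served (level_graph K t) (assign A b') i
          \<longleftrightarrow> i < N \<and> (\<exists>j<items_before K (Suc t). win w i j)"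
        unfolding served_def level_graph_def win_def N_def using same by (auto; metis)
    qed
    also have "\<dots> = (\<Sum>i<N. level_values K w i * of_bool (\<exists>j<items_before K (Suc t). win w i j))"
      by (rule sum.mono_neutral_cong_right) (use n in \<open>auto simp: N_def\<close>)
    finally show ?thesis unfolding b'_def by simp
  qed
  then have "(\<Sum>w\<in>\<Omega>. \<Sum>t<K. (1 / 2) ^ t *
      welfare n (level_values K w) (level_graph K t)
        (assign A (truthful_bids (level_values K w) (level_graph K t))))
    \<le> (\<Sum>w\<in>\<Omega>. \<Sum>t<K. (1 / 2) ^ t * (\<Sum>i<N. level_values K w i *
        of_bool (\<exists>j<items_before K (Suc t). win w i j)))"
    by (intro sum_mono mult_left_mono) auto
  also have "\<dots> \<le> 10 * real (card \<Omega>)"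
    unfolding \<Omega>_def level_values_def N_def
    by (rule weighted_gain_le[where win = win])
      (use K in simp, blast intro: one_item, blast intro: one_buyer, blast intro: same_item[unfolded N_def])
  finally show ?thesis .
qed

text \<open>It suffices to match buyers of level \<open>t\<close>: they want all arriving items, of
  which there are at least \<open>K ^ t\<close>.\<close>

lemma opt_level_ge:
  assumes n: "items_before K K \<le> n" and t: "t < K"
  shows "phase_value K t * real (min (card {i \<in> {..<items_before K K}. phase K (w i) = t}) (K ^ t))
    \<le> opt n (level_values K w) (level_graph K t)"
proof -
  define N where "N = items_before K K"
  define X where "X = {i \<in> {..<N}. phase K (w i) = t}"
  have "min (card X) (K ^ t) \<le> card X" by simp
  then obtain C where C: "C \<subseteq> X" "card C = min (card X) (K ^ t)"
    by (rule obtain_subset_with_card_n) auto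
  have fin: "finite C" using C(1) finite_subset unfolding X_def by fastforce
  have "card C \<le> card {..<items_before K (Suc t)}"
    using C(2) by (simp add: items_before_def)
  then obtain f where f: "f ` C \<subseteq> {..<items_before K (Suc t)}" "inj_on f C"
    using card_le_inj[OF fin, of "{..<items_before K (Suc t)}"] by auto
  define \<mu> where "\<mu> j = (if j \<in> f ` C then Some (the_inv_into C f j) else None)" for j
  have \<mu>: "\<mu> j = Some i \<longleftrightarrow> i \<in> C \<and> f i = j" for i j
    unfolding \<mu>_def using the_inv_into_f_f[OF f(2)] inj_onD[OF f(2)] by auto
  have CN: "i < N" if "i \<in> C" for i using that C(1) unfolding X_def by auto
  have "inj_on \<mu> (dom \<mu>)" by (rule inj_onI) (metis \<mu> domD)
  then have "matching (level_graph K t) \<mu>"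
    unfolding matching_def using CN f(1) by (auto simp: \<mu> level_graph_def N_def)
  moreover have "finite (level_graph K t)" by (simp add: level_graph_def)
  ultimately have "welfare n (level_values K w) (level_graph K t) \<mu> \<le> opt n (level_values K w) (level_graph K t)"
    unfolding opt_def by (intro Max_ge finite_imageI finite_matchings) auto
  moreover have "phase_value K t * real (card C) \<le> welfare n (level_values K w) (level_graph K t) \<mu>"
  proof -
    have "phase_value K t * real (card C) = (\<Sum>i\<in>C. level_values K w i * of_bool (served (level_graph K t) \<mu> i))"
    proof -
      have "served (level_graph K t) \<mu> i" "level_values K w i = phase_value K t" if "i \<in> C" for i
        using that CN[OF that] C(1) f(1) unfolding served_def level_values_def X_def
        by (auto simp: \<mu> level_graph_def N_def)
      then show ?thesis by simp
    qed
    also have "\<dots> \<le> welfare n (level_values K w) (level_graph K t) \<mu>"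
      unfolding welfare_def
      by (rule sum_mono2) (use CN n in \<open>auto simp: N_def level_values_nonneg intro: less_le_trans\<close>)
    finally show ?thesis .
  qed
  ultimately show ?thesis using C(2) unfolding X_def N_def by simp
qed

text \<open>On average at least \<open>K ^ t / 2\<close> buyers of level \<open>t\<close> can be
  matched. Their value \<open>(2 / K) ^ t\<close> and the weight \<open>(1 / 2) ^ t\<close> turn
  this into \<open>1 / 2\<close> for each of the \<open>K\<close> stopping times.\<close>

lemma weighted_opt_ge:
  assumes K: "1 \<le> K" and n: "items_before K K \<le> n"
  defines "\<Omega> \<equiv> {..<items_before K K} \<rightarrow>\<^sub>E {..<items_before K K}"
  shows "real K / 2 * card \<Omega> \<le> (\<Sum>w\<in>\<Omega>. \<Sum>t<K. (1 / 2) ^ t * opt n (level_values K w) (level_graph K t))"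
proof -
  define N where "N = items_before K K"
  define hits where "hits w t = real (min (card {i \<in> {..<N}. phase K (w i) = t}) (K ^ t))" for w t
  have hits: "real K ^ t / 2 * card \<Omega> \<le> (\<Sum>w\<in>\<Omega>. hits w t)" if t: "t < K" for t
  proof -
    define U where "U = {a. a < N \<and> phase K a = t}"
    have U: "card U = K ^ t" unfolding U_def N_def by (rule card_phase[OF K t])
    then have "U \<noteq> {}" using K by auto
    then have "real (card U) / 2 * card \<Omega> \<le> (\<Sum>w\<in>\<Omega>. real (min (card {i \<in> {..<N}. w i \<in> U}) (card U)))"
      unfolding \<Omega>_def N_def[symmetric] by (intro sum_min_hits_ge) (auto simp: U_def)
    also have "\<dots> = (\<Sum>w\<in>\<Omega>. hits w t)"
    proof (rule sum.cong[OF refl])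
      fix w assume "w \<in> \<Omega>"
      then have "{i \<in> {..<N}. w i \<in> U} = {i \<in> {..<N}. phase K (w i) = t}"
        unfolding \<Omega>_def U_def N_def by (auto simp: PiE_iff)
      then show "real (min (card {i \<in> {..<N}. w i \<in> U}) (card U)) = hits w t"
        by (simp add: hits_def U)
    qed
    finally show ?thesis by (simp add: U)
  qed
  have "real K / 2 * card \<Omega> = (\<Sum>t<K. (1 / 2) ^ t * phase_value K t * (real K ^ t / 2 * card \<Omega>))"
  proof -
    have "(1 / 2) ^ t * phase_value K t * (real K ^ t / 2 * card \<Omega>) = card \<Omega> / 2" for t
    proof -
      have "(1 / 2) ^ t * phase_value K t * (real K ^ t / 2 * card \<Omega>)
          = (1 / 2) ^ t * (real K ^ t * phase_value K t) * (card \<Omega> / 2)" by simp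
      also have "\<dots> = card \<Omega> / 2"
        by (simp only: phase_value_mult[OF K]) (simp flip: power_mult_distrib)
      finally show ?thesis .
    qed
    then show ?thesis by (simp only: sum_constant card_lessThan)
  qed
  also have "\<dots> \<le> (\<Sum>t<K. (1 / 2) ^ t * phase_value K t * (\<Sum>w\<in>\<Omega>. hits w t))"
    by (intro sum_mono mult_left_mono hits) (auto simp: phase_value_def)
  also have "\<dots> = (\<Sum>w\<in>\<Omega>. \<Sum>t<K. (1 / 2) ^ t * (phase_value K t * hits w t))"
    unfolding sum_distrib_left by (subst sum.swap) (simp only: mult_ac)
  also have "\<dots> \<le> (\<Sum>w\<in>\<Omega>. \<Sum>t<K. (1 / 2) ^ t * opt n (level_values K w) (level_graph K t))"
    unfolding hits_def N_def by (intro sum_mono mult_left_mono opt_level_ge n) auto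
  finally show ?thesis .
qed

section \<open>Randomized mechanisms\<close>

lemma integrable_welfare:
  assumes R: "randomized_truthful_mechanism n m R" and E: "market n m v E"
    and b: "b \<in> bid_profiles n m"
  shows "integrable R (\<lambda>A. welfare n v E (assign A b))"
proof -
  interpret prob_space R using R unfolding randomized_truthful_mechanism_def by blast
  have [measurable]: "(\<lambda>A. assign A b j) \<in> R \<rightarrow>\<^sub>M count_space UNIV" if "j < m" for j
    using R b that unfolding randomized_truthful_mechanism_def by blast
  \<comment> \<open>Measurability is given item by item, so being served is written as a finite
    disjunction over items.\<close>
  have served: "served E \<mu> i \<longleftrightarrow> (\<exists>j\<in>{j. j < m \<and> (i, j) \<in> E}. \<mu> j = Some i)" for \<mu> i
    using E unfolding served_def market_def by auto
  have pred: "Measurable.pred R (\<lambda>A. served E (assign A b) i)" for i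
    unfolding served by (intro pred_intros_finite) auto
  have "(\<lambda>A. of_bool (served E (assign A b) i) :: real) \<in> borel_measurable R" for i
    unfolding of_bool_def using pred[of i] by measurable
  then have "(\<lambda>A. welfare n v E (assign A b)) \<in> borel_measurable R"
    unfolding welfare_def by (intro borel_measurable_sum borel_measurable_times) auto
  moreover have "norm (welfare n v E (assign A b)) \<le> (\<Sum>i<n. \<bar>v i\<bar>)" for A
    unfolding welfare_def real_norm_def by (rule order_trans[OF sum_abs]) (intro sum_mono, auto)
  ultimately show ?thesis by (intro integrable_const_bound[of _ "\<Sum>i<n. \<bar>v i\<bar>"]) auto
qed

text \<open>Yao's principle: the competitive inequalities are averaged over the hard instances, and
  exchanging this average with the expectation over \<open>R\<close> reduces the claim to
  deterministic mechanisms. The result is \<open>K / 2 \<le> 10 * \<alpha>\<close>.\<close>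

lemma competitive_ge:
  assumes R: "randomized_truthful_mechanism n m R" and comp: "competitive n m R \<alpha>" and \<alpha>: "0 \<le> \<alpha>"
    and K: "3 \<le> K" and n: "items_before K K \<le> n" and m: "items_before K K \<le> m"
  shows "real K / 20 \<le> \<alpha>"
proof -
  interpret prob_space R using R unfolding randomized_truthful_mechanism_def by blast
  define \<Omega> where "\<Omega> = ({..<items_before K K} \<rightarrow>\<^sub>E {..<items_before K K})"
  define sw where "sw w t A = welfare n (level_values K w) (level_graph K t)
    (assign A (truthful_bids (level_values K w) (level_graph K t)))" for w t and A :: mechanism
  have int: "integrable R (sw w t)" if "t < K" for w t
    unfolding sw_def
    using integrable_welfare[OF R market_level[OF n m that] level_bids_in_bid_profiles[OF n m that]] .
  have int_sum: "integrable R (\<lambda>A. \<Sum>w\<in>\<Omega>. \<Sum>t<K. (1 / 2) ^ t * sw w t A)"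
    by (intro Bochner_Integration.integrable_sum integrable_mult_right int) auto
  have "real K / 2 * card \<Omega> \<le> (\<Sum>w\<in>\<Omega>. \<Sum>t<K. (1 / 2) ^ t * opt n (level_values K w) (level_graph K t))"
    unfolding \<Omega>_def using K by (intro weighted_opt_ge n) simp
  also have "\<dots> \<le> (\<Sum>w\<in>\<Omega>. \<Sum>t<K. (1 / 2) ^ t * (\<alpha> * (\<integral>A. sw w t A \<partial>R)))"
    unfolding sw_def using comp market_level[OF n m] unfolding competitive_def
    by (intro sum_mono mult_left_mono) auto
  also have "\<dots> = \<alpha> * (\<integral>A. (\<Sum>w\<in>\<Omega>. \<Sum>t<K. (1 / 2) ^ t * sw w t A) \<partial>R)"
  proof -
    have "(\<integral>A. (\<Sum>w\<in>\<Omega>. \<Sum>t<K. (1 / 2) ^ t * sw w t A) \<partial>R)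
        = (\<Sum>w\<in>\<Omega>. \<integral>A. (\<Sum>t<K. (1 / 2) ^ t * sw w t A) \<partial>R)"
      by (intro Bochner_Integration.integral_sum Bochner_Integration.integrable_sum
          integrable_mult_right int) auto
    also have "\<dots> = (\<Sum>w\<in>\<Omega>. \<Sum>t<K. \<integral>A. (1 / 2) ^ t * sw w t A \<partial>R)"
      by (intro sum.cong refl Bochner_Integration.integral_sum integrable_mult_right int) auto
    finally have "(\<integral>A. (\<Sum>w\<in>\<Omega>. \<Sum>t<K. (1 / 2) ^ t * sw w t A) \<partial>R)
        = (\<Sum>w\<in>\<Omega>. \<Sum>t<K. (1 / 2) ^ t * (\<integral>A. sw w t A \<partial>R))" by simp
    then show ?thesis by (simp only: sum_distrib_left mult.left_commute)
  qed
  also have "\<dots> \<le> \<alpha> * (10 * real (card \<Omega>))"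
  proof (intro mult_left_mono \<alpha> integral_le_const int_sum AE_I2)
    fix A assume "A \<in> space R"
    then have "online_mechanism n m A" "truthful n m A" "individually_rational n m A"
      using R unfolding randomized_truthful_mechanism_def by auto
    then show "(\<Sum>w\<in>\<Omega>. \<Sum>t<K. (1 / 2) ^ t * sw w t A) \<le> 10 * real (card \<Omega>)"
      unfolding sw_def \<Omega>_def by (rule weighted_welfare_le[OF _ _ _ K n m])
  qed
  finally have "real K / 2 * card \<Omega> \<le> (10 * \<alpha>) * card \<Omega>" by simp
  moreover have "0 < card \<Omega>"
    unfolding \<Omega>_def by (auto simp: card_gt_0_iff PiE_eq_empty_iff finite_PiE)
  ultimately show ?thesis by simp
qed

section \<open>Choice of the number of phases\<close>

text \<open>With \<open>l = ln \<nu>\<close>, the bound on \<open>K\<close> gives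
  \<open>K \<le> l\<close>, so \<open>ln K \<le> ln l\<close> and
  \<open>K * ln K \<le> l\<close>.\<close>

lemma power_self_le:
  fixes \<nu> :: nat
  assumes "1 \<le> K" "1 \<le> ln (ln \<nu>)" "real K \<le> ln \<nu> / (2 * ln (ln \<nu>))"
  shows "K ^ K \<le> \<nu>"
proof -
  define l where "l = ln (real \<nu>)"
  have "0 \<le> l" unfolding l_def by (cases "\<nu> = 0") auto
  then have l: "1 < l" using assms(2) unfolding l_def[symmetric]
    by (smt (verit) ln_ge_zero_iff ln_le_zero_iff ln_0)
  then have "0 < \<nu>" unfolding l_def by (cases "\<nu> = 0") auto
  have ll: "1 \<le> ln l" using assms(2) by (simp add: l_def)
  have KL: "real K * (2 * ln l) \<le> l" using assms(3) ll by (simp add: l_def field_simps)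
  have "real K * 1 \<le> real K * (2 * ln l)" using ll by (intro mult_left_mono) auto
  then have "real K \<le> l" using KL by simp
  then have "ln (real K) \<le> ln l" using assms(1) l by (subst ln_le_cancel_iff) auto
  then have "real K * ln (real K) \<le> real K * (2 * ln l)" using ll by (intro mult_left_mono) auto
  then have "real K * ln (real K) \<le> l" using KL by linarith
  then have "ln (real K ^ K) \<le> ln (real \<nu>)" using assms(1) by (simp add: ln_realpow l_def)
  then have "real K ^ K \<le> real \<nu>" using assms(1) \<open>0 < \<nu>\<close> by (subst (asm) ln_le_cancel_iff) auto
  then show ?thesis by (metis of_nat_le_iff of_nat_power)
qed

theorem corollary1:
  "\<exists>c::real. c > 0 \<and>
    (\<forall>\<^sub>F \<nu>::nat in sequentially. \<forall>n m. min m n = \<nu> \<longrightarrow>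
      (\<forall>R. randomized_truthful_mechanism n m R \<longrightarrow>
        ereal (c * (ln (real \<nu>) / ln (ln (real \<nu>)))) \<le> competitive_ratio n m R))"
\<comment> \<open>With \<open>f\<close> as below and \<open>K\<close> its floor,
  \<open>f \<ge> 6\<close> yields \<open>K \<ge> 3\<close> and
  \<open>K \<ge> f - 1 \<ge> f / 2\<close>. So \<open>K / 20 \<ge> f / 40\<close>, and the 2 in the
  denominator of \<open>f\<close> turns 40 into 80.\<close>
proof (intro exI[of _ "1 / 80"] conjI)
  have "\<forall>\<^sub>F \<nu>::nat in sequentially. 6 \<le> ln (real \<nu>) / (2 * ln (ln (real \<nu>)))"
    by real_asymp
  moreover have "\<forall>\<^sub>F \<nu>::nat in sequentially. 1 \<le> ln (ln (real \<nu>))"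
    by real_asymp
  ultimately show "\<forall>\<^sub>F \<nu>::nat in sequentially. \<forall>n m. min m n = \<nu> \<longrightarrow>
      (\<forall>R. randomized_truthful_mechanism n m R \<longrightarrow>
        ereal (1 / 80 * (ln (real \<nu>) / ln (ln (real \<nu>)))) \<le> competitive_ratio n m R)"
  proof eventually_elim
    case (elim \<nu>)
    define f where "f = ln (real \<nu>) / (2 * ln (ln (real \<nu>)))"
    define K where "K = nat \<lfloor>f\<rfloor>"
    have K: "real K \<le> f" "f - 1 \<le> real K"
      using elim(1) unfolding K_def f_def[symmetric] by linarith+
    then have K3: "3 \<le> K" using elim(1) unfolding f_def[symmetric] by linarith
    then have "items_before K K \<le> \<nu>"
      using items_before_le_power[of K K] power_self_le[of K \<nu>] elim K unfolding f_def by simp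
    then have bound: "ereal (1 / 80 * (ln (real \<nu>) / ln (ln (real \<nu>)))) \<le> ereal \<alpha>"
      if "min m n = \<nu>" "randomized_truthful_mechanism n m R" "1 \<le> \<alpha>" "competitive n m R \<alpha>" for n m R \<alpha>
    proof -
      have "real K / 20 \<le> \<alpha>"
        using competitive_ge[OF that(2,4) _ K3] that(1,3) \<open>items_before K K \<le> \<nu>\<close> by simp
      moreover have "1 / 80 * (ln (real \<nu>) / ln (ln (real \<nu>))) = f / 40"
        by (simp add: f_def)
      ultimately show ?thesis using K elim(1) unfolding f_def[symmetric] by simp
    qed
    show ?case
      unfolding competitive_ratio_def using bound by (intro allI impI Inf_greatest) blast
  qed
qed simp

end
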